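(* Assume GCH. For every infinite regular cardinal $\kappa$ and every sequence $\bar p=\langle p_\delta:\delta<\kappa^{++}\rangle$ of partitions $p_\delta:[\kappa^{++}]^2\to\theta_\delta$ with $\theta_\delta\le\kappa^+$, $\Pr_0(\kappa^{++},\kappa^{++},\kappa^{++},\kappa)_{\bar p}$ holds.
   Context: $\Pr_0(\kappa,\mu,\lambda,\chi)_p$ for $p:[\kappa]^2\to\theta$: there is $f:[\kappa]^2\to\lambda$ such that for every $\xi<\chi$, every pairwise disjoint family $\mathcal A\subseteq[\kappa]^\xi$ with $|\mathcal A|=\mu$, and every matrix $\langle\zeta_{i,j}:i,j<\xi\rangle$ of elements of $\lambda^\theta$, there are $a,b\in\mathcal A$ with $\max a<\min b$ and $f(a(i),b(j))=\zeta_{i,j}(p(a(i),b(j)))$ for all $i,j<\xi$, where $a(i),b(j)$ are the $i$-th, $j$-th elements in increasing order. With a sequence $\bar p=\langle p_\delta\rangle$: a single $f$ witnesses this for every $p_\delta$. *)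

theory Defs
  imports Main
begin

unbundle cardinal_syntax

text \<open>Ordinals below the top cardinal are represented as elements of a type 'a carrying a
 well-order r (a cardinal order, of order type kappa^{++}); an ordinal x is identified with the
 initial segment underS r x.\<close>

definition ord_el :: "'a rel \<Rightarrow> 'a set \<Rightarrow> 'a \<Rightarrow> 'a" where
  "ord_el r a i = (THE x. x \<in> a \<and>
      Restr r {y \<in> a. (y, x) \<in> r \<and> y \<noteq> x} =o Restr r (underS r i))"

definition GCH_upto :: "'a itself \<Rightarrow> bool" where
  "GCH_upto (_ :: 'a itself) \<longleftrightarrow>
     (\<forall>S :: 'a set. infinite S \<longrightarrow> card_of (Pow S) =o cardSuc (card_of S))"

text \<open>Pr_0(lambda, lambda, lambda, chi)_{p-bar}, where lambda is the order type of r
 (lambda = kappa = mu in the notation of the definition), chi is the ordinal underS r chi,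
 and p delta is the partition p_delta, delta ranging over lambda.  Colours live in 'a;
 the range condition p_delta < theta_delta is imposed separately.
 The matrix entries zeta_{i,j} : theta -> lambda are given as functions 'a => 'a (only their
 values below theta matter).\<close>
definition Pr0_seq :: "'a rel \<Rightarrow> 'a \<Rightarrow> ('a \<Rightarrow> 'a \<Rightarrow> 'a \<Rightarrow> 'a) \<Rightarrow> bool" where
  "Pr0_seq r chi p \<longleftrightarrow>
    (\<exists>f :: 'a \<Rightarrow> 'a \<Rightarrow> 'a.
      \<forall>\<delta> \<xi> (A :: 'a set set) (\<zeta> :: 'a \<Rightarrow> 'a \<Rightarrow> 'a \<Rightarrow> 'a).
        \<xi> \<in> underS r chi
        \<and> (\<forall>a \<in> A. Restr r a =o Restr r (underS r \<xi>))
        \<and> pairwise disjnt A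
        \<and> card_of A =o r
        \<longrightarrow> (\<exists>a \<in> A. \<exists>b \<in> A.
              (\<forall>x \<in> a. \<forall>y \<in> b. (x, y) \<in> r \<and> x \<noteq> y)
              \<and> (\<forall>i \<in> underS r \<xi>. \<forall>j \<in> underS r \<xi>.
                   f (ord_el r a i) (ord_el r b j)
                   = \<zeta> i j (p \<delta> (ord_el r a i) (ord_el r b j)))))"

end

theory Submission
  imports Defs
begin

text \<open>Write \<open>\<mu> = \<kappa>\<^sup>+\<close> and \<open>\<lambda> = \<mu>\<^sup>+\<close>. By GCH the families of \<open>\<mu>\<close> many disjoint subsets of \<open>\<lambda>\<close> of
  size at most \<open>\<kappa>\<close> can be listed as \<open>S \<alpha>\<close>, \<open>\<alpha> < \<lambda>\<close>, and each of them is arranged in \<open>\<mu>\<close> levels whose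
  members carry codes below \<open>\<mu>\<close>. Column \<open>\<beta>\<close> of the colouring looks, through an injection
  \<open>e \<beta> : \<beta> \<rightarrow> \<mu>\<close>, for the lowest level on which a point \<open>x\<close> occurs in some \<open>S \<alpha>\<close>, \<open>\<alpha> < \<beta>\<close>, and
  obeys the code found there. Different columns may disagree about \<open>x\<close>, but for at most \<open>\<kappa>\<close> many
  columns beyond \<open>\<alpha>\<close> a closure argument of length \<open>\<omega>\<close> yields a level on which all of them read a
  prescribed code off one and the same member \<open>a\<close> of \<open>S \<alpha>\<close>.

  A code is a set of at most \<open>\<kappa>\<close> instructions which address a column \<open>\<beta>\<close> through the trace of a
  subset \<open>X \<beta>\<close> of \<open>\<mu>\<close> on a set of size at most \<open>\<kappa>\<close>, as in the Engelking--Karlowicz theorem; as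
  \<open>\<mu>\<^sup>\<kappa> = \<mu>\<close> there are only \<open>\<mu>\<close> many codes. Finally \<open>\<lambda>\<^sup>\<mu> = \<lambda>\<close>, so a colour can itself code
  an index \<open>\<delta>\<close> with a function \<open>\<theta> \<delta> \<rightarrow> \<lambda>\<close>, which is then applied to \<open>p \<delta>\<close>; this handles all
  partitions at once.\<close>

section \<open>Cardinal arithmetic at an infinite cardinal and its successor\<close>

lemma card_of_Pow_mono:
  assumes "|A| \<le>o |B|" shows "|Pow A| \<le>o |Pow B|"
proof -
  obtain f where f: "inj_on f A" "f ` A \<subseteq> B"
    using assms card_of_ordLeq by metis
  have "image f ` Pow A \<subseteq> Pow B" using f(2) by blast
  then show ?thesis using inj_on_image_Pow[OF f(1)] card_of_ordLeq by metis
qed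

lemma Field_cardSuc_infinite: "infinite K \<Longrightarrow> infinite (Field (cardSuc |K| ))"
  by (subst cardSuc_finite) (simp_all add: card_of_card_order_on Field_card_of)

lemma cardSuc_infinite_Field:
  assumes "R =o cardSuc |K|" and "infinite K"
  shows "infinite (Field R)"
proof -
  have "infinite (Field (cardSuc |K| ))"
    using assms(2) Field_cardSuc_infinite by blast
  then show ?thesis
    using assms(1) card_of_cong card_of_ordIso_finite by metis
qed

lemma cardSuc_underS_small:
  assumes "Card_order R" and "R =o cardSuc |K|"
  shows "|underS R x| \<le>o |K|"
proof (cases "x \<in> Field R")
  case True
  then have "|underS R x| <o cardSuc |K|"
    using card_of_underS[OF assms(1)] assms(2) ordLess_ordIso_trans by blast
  then show ?thesis
    by (rule iffD1[OF cardSuc_ordLeq_ordLess[OF card_of_Card_order card_of_Card_order]])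
next
  case False
  then show ?thesis by (simp add: underS_empty card_of_empty)
qed

text \<open>An infinite successor cardinal is regular; an unbounded \<open>P\<close> would be
  cofinal and hence of size \<open>cardSuc |K|\<close>.\<close>

lemma cardSuc_small_subset_bounded:
  assumes R: "Card_order R" "R =o cardSuc |K|" and K: "infinite K"
    and P: "P \<subseteq> Field R" "|P| \<le>o |K|"
  shows "\<exists>x\<in>Field R. P \<subseteq> underS R x"
proof (rule ccontr)
  assume unb: "\<not> ?thesis"
  have inf: "infinite (Field R)" by (rule cardSuc_infinite_Field[OF R(2) K])
  interpret wo: wo_rel R
    using R(1) by (simp add: card_order_on_well_order_on wo_rel_def)
  have "cofinal P R"
    unfolding cofinal_def
  proof
    fix a assume "a \<in> Field R"
    then obtain b where b: "b \<in> Field R" "a \<noteq> b" "(a, b) \<in> R"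
      using infinite_Card_order_limit[OF R(1) inf] by blast
    obtain x where x: "x \<in> P" "x \<notin> underS R b" using unb b(1) by blast
    then have "(b, x) \<in> R"
      using b(1) P(1) wo.TOTALS wo.REFL unfolding underS_def refl_on_def by blast
    then have "(a, x) \<in> R" "a \<noteq> x"
      using b(2,3) wo.TRANS wo.ANTISYM unfolding trans_def antisym_def by blast+
    then show "\<exists>b\<in>P. a \<noteq> b \<and> (a, b) \<in> R" using x(1) by blast
  qed
  moreover have "regularCard R"
  proof (rule regularCard_ordIso[OF ordIso_symmetric[OF R(2)]])
    show "Cinfinite (cardSuc |K| )"
      using Field_cardSuc_infinite[OF K] cardSuc_Card_order[OF card_of_Card_order]
      unfolding cinfinite_def by blast
    show "regularCard (cardSuc |K| )"
      by (rule infinite_cardSuc_regularCard) (simp_all add: K Field_card_of card_of_card_order_on)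
  qed
  ultimately have "|P| =o R" using P(1) unfolding regularCard_def by blast
  then have "cardSuc |K| \<le>o |K|"
    using R(2) P(2) by (meson ordIso_ordLeq_trans ordIso_symmetric ordIso_transitive)
  then show False
    using cardSuc_greater[OF card_of_Card_order] not_ordLess_ordLeq by blast
qed

text \<open>This is \<open>(B\<^sup>+)\<^sup>B = B\<^sup>+\<close> under GCH at \<open>B\<close>: by
  regularity every such subset of the successor lies in a proper initial segment, and each of the
  \<open>B\<^sup>+\<close> segments has at most \<open>2\<^sup>B = B\<^sup>+\<close>
  subsets.\<close>

lemma card_of_small_subsets:
  assumes B: "infinite B" "|Pow B| =o cardSuc |B|" and Q: "|Q| \<le>o cardSuc |B|"
  shows "|{C. C \<subseteq> Q \<and> |C| \<le>o |B|}| \<le>o cardSuc |B|"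
proof -
  let ?R = "cardSuc |B|"
  have R: "Card_order ?R" by (rule cardSuc_Card_order[OF card_of_Card_order])
  have inf: "infinite (Field ?R)" using B(1) Field_cardSuc_infinite by blast
  have "|Q| \<le>o |Field ?R|"
    using Q card_of_Field_ordIso[OF R] ordIso_symmetric ordLeq_ordIso_trans by blast
  then obtain g where g: "inj_on g Q" "g ` Q \<subseteq> Field ?R"
    using card_of_ordLeq by metis
  let ?X = "{C. C \<subseteq> Q \<and> |C| \<le>o |B|}"
  have "inj_on (image g) ?X"
    by (rule inj_on_subset[OF inj_on_image_Pow[OF g(1)]]) blast
  moreover have "image g ` ?X \<subseteq> (\<Union>x\<in>Field ?R. Pow (underS ?R x))"
  proof clarify
    fix C assume C: "C \<subseteq> Q" "|C| \<le>o |B|"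
    have 1: "g ` C \<subseteq> Field ?R" using C g by blast
    have 2: "|g ` C| \<le>o |B|" by (rule ordLeq_transitive[OF card_of_image C(2)])
    obtain x where "x \<in> Field ?R" "g ` C \<subseteq> underS ?R x"
      using cardSuc_small_subset_bounded[OF R ordIso_refl[OF R] B(1) 1 2] by blast
    then show "g ` C \<in> (\<Union>x\<in>Field ?R. Pow (underS ?R x))" by blast
  qed
  ultimately have "|?X| \<le>o |\<Union>x\<in>Field ?R. Pow (underS ?R x)|"
    by (intro card_of_ordLeq[THEN iffD1] exI conjI)
  also have "|\<Union>x\<in>Field ?R. Pow (underS ?R x)| \<le>o ?R"
  proof (rule card_of_UNION_ordLeq_infinite_Field[OF inf R])
    show "|Field ?R| \<le>o ?R"
      using card_of_Field_ordIso[OF R] ordIso_imp_ordLeq by blast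
    show "\<forall>x\<in>Field ?R. |Pow (underS ?R x)| \<le>o ?R"
      using ordLeq_ordIso_trans[OF card_of_Pow_mono[OF cardSuc_underS_small[OF R ordIso_refl[OF R]]] B(2)]
      by (rule ballI)
  qed
  finally show ?thesis .
qed

text \<open>Recursion along the cardinal order on \<open>I\<close>: before stage \<open>i\<close>
  fewer than \<open>|S|\<close> values are used up, and together with \<open>Bad i\<close> they
  cannot exhaust the infinite set \<open>S\<close>.\<close>

lemma injective_choice_avoiding:
  assumes S: "infinite S" "|I| \<le>o |S|" and bad: "\<And>i. i \<in> I \<Longrightarrow> |Bad i| <o |S|"
  shows "\<exists>s. inj_on s I \<and> (\<forall>i\<in>I. s i \<in> S - Bad i)"
proof -
  let ?W = "|I|"
  interpret wo: wo_rel ?W using card_of_Well_order by (simp add: wo_rel_def)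
  let ?P = "\<lambda>f i x. i \<in> I \<longrightarrow> x \<in> S - Bad i - f ` underS ?W i"
  have "\<exists>s. \<forall>i. ?P s i (s i)"
  proof (rule dependent_wf_choice[OF wo.WF])
    fix f g :: "'b \<Rightarrow> 'a" and i x
    assume "\<And>z. (z, i) \<in> ?W - Id \<Longrightarrow> f z = g z"
    then have "f ` underS ?W i = g ` underS ?W i"
      unfolding underS_def by (intro image_cong) auto
    then show "?P f i x = ?P g i x" by simp
  next
    fix f :: "'b \<Rightarrow> 'a" and i
    show "\<exists>x. ?P f i x"
    proof (cases "i \<in> I")
      case True
      have "|underS ?W i| <o |S|"
        using card_of_underS[OF card_of_Card_order, of i I] True S(2)
          ordLess_ordLeq_trans by (metis Field_card_of)
      then have "|f ` underS ?W i| <o |S|" using card_of_image ordLeq_ordLess_trans by blast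
      then have less: "|Bad i \<union> f ` underS ?W i| <o |S|"
        using card_of_Un_ordLess_infinite[OF S(1) bad[OF True]] by blast
      have "\<not> S \<subseteq> Bad i \<union> f ` underS ?W i"
        using less card_of_mono1 not_ordLess_ordLeq by blast
      then show ?thesis by blast
    qed blast
  qed
  then obtain s where s: "\<And>i. i \<in> I \<Longrightarrow> s i \<in> S - Bad i - s ` underS ?W i" by blast
  have "inj_on s I"
  proof (rule inj_onI, rule ccontr)
    fix i j assume ij: "i \<in> I" "j \<in> I" "s i = s j" "i \<noteq> j"
    then have "i \<in> underS ?W j \<or> j \<in> underS ?W i"
      using wo.TOTALS unfolding underS_def by (auto simp: Field_card_of)
    then show False using s[OF ij(1)] s[OF ij(2)] ij(3) by (metis DiffD2 imageI)
  qed
  then show ?thesis using s by blast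
qed

section \<open>Order types and the increasing enumeration of a set\<close>

lemma Restr_underS_inject:
  assumes w: "Well_order w" and xy: "x \<in> Field w" "y \<in> Field w"
    and iso: "Restr w (underS w x) =o Restr w (underS w y)"
  shows "x = y"
proof (rule ccontr)
  assume ne: "x \<noteq> y"
  interpret wo: wo_rel w using w by (simp add: wo_rel_def)
  have *: False if "(a, b) \<in> w" "a \<noteq> b" "Restr w (underS w a) =o Restr w (underS w b)" for a b
  proof -
    have "underS w a \<subset> underS w b"
      using that(1,2) underS_incr[OF wo.TRANS wo.ANTISYM that(1)] unfolding underS_def by blast
    then have "Restr w (underS w a) <o Restr w (underS w b)"
      using ofilter_subset_ordLess[OF w wo.underS_ofilter wo.underS_ofilter] by blast
    then show False using that(3) not_ordLess_ordIso by blast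
  qed
  have "(x, y) \<in> w \<or> (y, x) \<in> w" using xy wo.TOTALS by blast
  then show False using *[of x y] *[of y x] ne iso ordIso_symmetric by blast
qed

text \<open>Justifies the \<open>THE\<close> in \<open>ord_el\<close>: the segment of
  \<open>i\<close> is shorter than that of \<open>\<xi>\<close>, hence than \<open>a\<close>, so it
  is isomorphic to an initial segment of \<open>a\<close>, and to only one.\<close>

lemma ord_el_props:
  assumes r: "Well_order r" "Field r = UNIV"
    and a: "Restr r a =o Restr r (underS r \<xi>)" and i: "i \<in> underS r \<xi>"
  shows "ord_el r a i \<in> a"
    and "Restr r {y \<in> a. (y, ord_el r a i) \<in> r \<and> y \<noteq> ord_el r a i} =o Restr r (underS r i)"
proof -
  interpret wo: wo_rel r using r(1) by (simp add: wo_rel_def)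
  let ?w = "Restr r a"
  have w: "Well_order ?w" by (rule Well_order_Restr[OF r(1)])
  have Fw: "Field ?w = a" using Refl_Field_Restr2[OF wo.REFL] r(2) by simp
  have uw: "Restr ?w (underS ?w x) = Restr r {y \<in> a. (y, x) \<in> r \<and> y \<noteq> x}" if "x \<in> a" for x
    using that unfolding underS_def by auto
  have "underS r i \<subset> underS r \<xi>"
    using i underS_incr[OF wo.TRANS wo.ANTISYM, of i \<xi>] unfolding underS_def by blast
  then have "Restr r (underS r i) <o Restr r (underS r \<xi>)"
    using ofilter_subset_ordLess[OF r(1) wo.underS_ofilter wo.underS_ofilter] by blast
  then have "Restr r (underS r i) <o ?w"
    using a ordIso_symmetric ordLess_ordIso_trans by blast
  then obtain x where x: "x \<in> a" "Restr r (underS r i) =o Restr ?w (underS ?w x)"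
    using ordLess_iff_ordIso_Restr[OF w Well_order_Restr[OF r(1)]] Fw by blast
  have "\<exists>!x. x \<in> a \<and> Restr r {y \<in> a. (y, x) \<in> r \<and> y \<noteq> x} =o Restr r (underS r i)"
  proof (rule ex1I[of _ x])
    show "x \<in> a \<and> Restr r {y \<in> a. (y, x) \<in> r \<and> y \<noteq> x} =o Restr r (underS r i)"
      using x(1) ordIso_symmetric[OF x(2)] unfolding uw[OF x(1)] by (rule conjI)
    fix z assume "z \<in> a \<and> Restr r {y \<in> a. (y, z) \<in> r \<and> y \<noteq> z} =o Restr r (underS r i)"
    then have z: "z \<in> a" "Restr ?w (underS ?w z) =o Restr r (underS r i)"
      using uw[of z] by simp_all
    show "z = x"
      by (rule Restr_underS_inject[OF w _ _ ordIso_transitive[OF z(2) x(2)]])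
        (simp_all add: Fw z(1) x(1))
  qed
  from theI'[OF this] show "ord_el r a i \<in> a"
    and "Restr r {y \<in> a. (y, ord_el r a i) \<in> r \<and> y \<noteq> ord_el r a i} =o Restr r (underS r i)"
    unfolding ord_el_def by blast+
qed

text \<open>Choosing a point of \<open>U\<close> from each such member is injective by
  disjointness.\<close>

lemma card_of_members_meeting:
  assumes F: "pairwise disjnt F" and U: "|U| \<le>o |B|"
  shows "|{a \<in> F. a \<inter> U \<noteq> {}}| \<le>o |B|"
proof -
  let ?g = "\<lambda>a. SOME x. x \<in> a \<inter> U"
  have g: "?g a \<in> a \<inter> U" if "a \<inter> U \<noteq> {}" for a
    using that by (intro someI_ex[of "\<lambda>x. x \<in> a \<inter> U"]) blast
  have "inj_on ?g {a \<in> F. a \<inter> U \<noteq> {}}"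
  proof (rule inj_onI, rule ccontr)
    fix a b assume ab: "a \<in> {a \<in> F. a \<inter> U \<noteq> {}}" "b \<in> {a \<in> F. a \<inter> U \<noteq> {}}" "?g a = ?g b" "a \<noteq> b"
    then have "?g a \<in> a" "?g a \<in> b" using g[of a] g[of b] by auto
    moreover have "disjnt a b" using F ab by (auto simp: pairwise_def)
    ultimately show False by (auto simp: disjnt_def)
  qed
  moreover have "?g ` {a \<in> F. a \<inter> U \<noteq> {}} \<subseteq> U" using g by blast
  ultimately have "|{a \<in> F. a \<inter> U \<noteq> {}}| \<le>o |U|"
    by (intro card_of_ordLeq[THEN iffD1] exI conjI)
  then show ?thesis by (rule ordLeq_transitive[OF _ U])
qed

section \<open>Three consecutive cardinals \<open>\<kappa>\<close>, \<open>\<mu>\<close>,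
  \<open>\<lambda>\<close>, given as \<open>K\<close>, \<open>M\<close>, \<open>r\<close>\<close>

locale double_successor =
  fixes r :: "'a rel" and K M :: "'a set"
  assumes r: "card_order r" and K_inf: "infinite K"
    and M: "|M| =o cardSuc |K|" and rM: "r =o cardSuc |M|"
begin

text \<open>Levels and codes are compared in the cardinal order \<open>|M|\<close>, which need not
  agree with \<open>r\<close> on \<open>M\<close>.\<close>

abbreviation below :: "'a \<Rightarrow> 'a set" where "below \<equiv> underS |M|"

abbreviation small :: "'b set \<Rightarrow> bool" where "small X \<equiv> |X| \<le>o |K|"

sublocale wo: wo_rel r
  using r card_order_on_Card_order[OF r] unfolding wo_rel_def card_order_on_def by metis

sublocale woM: wo_rel "|M|"
  using card_of_Well_order by (simp add: wo_rel_def)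

lemma Field_r: "Field r = UNIV"
  using r card_order_on_Card_order by blast

lemma M_inf: "infinite M"
  using cardSuc_infinite_Field[OF M K_inf] by (simp add: Field_card_of)

lemma below_small: "small (below x)"
  by (rule cardSuc_underS_small[OF card_of_Card_order M])

lemma below_bounded:
  assumes "P \<subseteq> M" "small P" shows "\<exists>x\<in>M. P \<subseteq> below x"
  using cardSuc_small_subset_bounded[OF card_of_Card_order M K_inf _ assms(2)] assms(1)
  by (simp add: Field_card_of)

lemma r_bounded:
  assumes "|P| \<le>o |M|" shows "\<exists>x. P \<subseteq> underS r x"
  using cardSuc_small_subset_bounded[OF _ rM M_inf _ assms] r
  by (simp add: Field_r)

lemma below_M: "x \<in> below y \<Longrightarrow> x \<in> M" "x \<in> below y \<Longrightarrow> y \<in> M"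
  unfolding underS_def by (auto simp: Field_card_of dest: FieldI1 FieldI2)

lemma below_trans: "x \<in> below y \<Longrightarrow> y \<in> below z \<Longrightarrow> x \<in> below z"
  using underS_incr[OF woM.TRANS woM.ANTISYM, of y z] unfolding underS_def by blast

lemma below_cases: "x \<in> M \<Longrightarrow> y \<in> M \<Longrightarrow> x \<in> below y \<or> x = y \<or> y \<in> below x"
  using woM.TOTALS unfolding underS_def by (auto simp: Field_card_of)

lemma underS_cases: "x \<in> underS r y \<or> x = y \<or> y \<in> underS r x"
  using wo.TOTALS unfolding underS_def by (auto simp: Field_r)

lemma small_less_M: "small X \<Longrightarrow> |X| <o |M|"
  using iffD2[OF cardSuc_ordLeq_ordLess[OF card_of_Card_order card_of_Card_order]]
    ordIso_symmetric[OF M] ordLess_ordIso_trans by blast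

lemma small_UN: "small I \<Longrightarrow> (\<And>i. i \<in> I \<Longrightarrow> small (A i)) \<Longrightarrow> small (\<Union>i\<in>I. A i)"
  by (rule card_of_UNION_ordLeq_infinite[OF K_inf]) blast+

lemma small_Un: "small A \<Longrightarrow> small B \<Longrightarrow> small (A \<union> B)"
  by (rule card_of_Un_ordLeq_infinite_Field) (simp_all add: K_inf Field_card_of card_of_card_order_on)

lemma small_image: "small A \<Longrightarrow> small (f ` A)"
  by (rule ordLeq_transitive[OF card_of_image])

lemma small_mono: "A \<subseteq> B \<Longrightarrow> small B \<Longrightarrow> small A"
  by (rule ordLeq_transitive[OF card_of_mono1])

lemma small_range_nat: "small (range (f :: nat \<Rightarrow> 'b))"
  using K_inf by (intro small_image) (simp add: infinite_iff_card_of_nat)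

lemma small_le_M: "small X \<Longrightarrow> |X| \<le>o |M|"
  by (rule ordLess_imp_ordLeq[OF small_less_M])

lemma small_Times: "small A \<Longrightarrow> small B \<Longrightarrow> small (A \<times> B)"
  by (rule card_of_Times_ordLeq_infinite_Field)
    (simp_all add: K_inf Field_card_of card_of_card_order_on)

lemma small_singleton: "small {x}"
  by (rule small_mono[OF _ small_range_nat[of "\<lambda>_. x"]]) blast

end

section \<open>Disjoint families arranged in levels, and the conflicts between them\<close>

locale disjoint_families = double_successor +
  fixes e :: "'a \<Rightarrow> 'a \<Rightarrow> 'a" and S :: "'a \<Rightarrow> 'a set set"
  assumes e_inj: "inj_on (e \<beta>) (underS r \<beta>)"
    and e_M: "\<alpha> \<in> underS r \<beta> \<Longrightarrow> e \<beta> \<alpha> \<in> M"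
    and S_card: "|S \<alpha>| =o |M|"
    and S_disjoint: "pairwise disjnt (S \<alpha>)"
    and S_small: "a \<in> S \<alpha> \<Longrightarrow> |a| \<le>o |K|"
begin

text \<open>The families \<open>S \<alpha>\<close> with \<open>\<alpha> < \<beta>\<close> that column \<open>\<beta>\<close> takes into account at level \<open>\<nu>\<close>.\<close>

definition active :: "'a \<Rightarrow> 'a \<Rightarrow> 'a set" where
  "active \<beta> \<nu> = {\<alpha> \<in> underS r \<beta>. e \<beta> \<alpha> \<in> below \<nu>}"

lemma active_small: "small (active \<beta> \<nu>)"
proof -
  have "inj_on (e \<beta>) (active \<beta> \<nu>)"
    by (rule inj_on_subset[OF e_inj]) (auto simp: active_def)
  moreover have "e \<beta> ` active \<beta> \<nu> \<subseteq> below \<nu>" by (auto simp: active_def)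
  ultimately have "|active \<beta> \<nu>| \<le>o |below \<nu>|"
    by (intro card_of_ordLeq[THEN iffD1] exI conjI)
  then show ?thesis by (rule ordLeq_transitive[OF _ below_small])
qed

text \<open>The set \<open>t (\<nu>, c)\<close> is placed on level \<open>\<nu>\<close> and carries the code \<open>c\<close>; only codes \<open>c < \<nu>\<close>
  are read on level \<open>\<nu>\<close>, so that each level contributes only \<open>|K|\<close> many points.\<close>

definition levelled :: "('a \<Rightarrow> 'a \<times> 'a \<Rightarrow> 'a set) \<Rightarrow> 'a \<Rightarrow> ('a \<times> 'a \<Rightarrow> 'a set) \<Rightarrow> bool" where
  "levelled s \<alpha> t \<longleftrightarrow> inj_on t (M \<times> M) \<and>
     (\<forall>\<nu>\<in>M. \<forall>c\<in>M. t (\<nu>, c) \<in> S \<alpha> \<and>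
       (\<forall>\<alpha>'\<in>active \<alpha> \<nu>. \<forall>c'\<in>below \<nu>. t (\<nu>, c) \<inter> s \<alpha>' (\<nu>, c') = {}))"

text \<open>Recursion on \<open>\<alpha>\<close>. The points to avoid on a level form a small set,
  which by disjointness meets few members of \<open>S \<alpha>\<close>; enough of its
  \<open>|M|\<close> members remain for an injective choice.\<close>

lemma ex_levelled: "\<exists>s. \<forall>\<alpha>. levelled s \<alpha> (s \<alpha>)"
proof (rule dependent_wf_choice[OF wo.WF])
  fix f g :: "'a \<Rightarrow> 'a \<times> 'a \<Rightarrow> 'a set" and \<alpha> t
  assume "\<And>z. (z, \<alpha>) \<in> r - Id \<Longrightarrow> f z = g z"
  then have "\<And>\<nu> z. z \<in> active \<alpha> \<nu> \<Longrightarrow> f z = g z"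
    unfolding active_def underS_def by auto
  then show "levelled f \<alpha> t = levelled g \<alpha> t" by (simp add: levelled_def)
next
  fix \<alpha> and s :: "'a \<Rightarrow> 'a \<times> 'a \<Rightarrow> 'a set"
  assume "\<And>\<alpha>'. (\<alpha>', \<alpha>) \<in> r - Id \<Longrightarrow> levelled s \<alpha>' (s \<alpha>')"
  then have prev: "\<alpha>' \<in> active \<alpha> \<nu> \<Longrightarrow> levelled s \<alpha>' (s \<alpha>')" for \<alpha>' \<nu>
    unfolding active_def underS_def by auto
  define U where "U \<nu> = (\<Union>\<alpha>'\<in>active \<alpha> \<nu>. \<Union>c'\<in>below \<nu>. s \<alpha>' (\<nu>, c'))" for \<nu>
  have U: "small (U \<nu>)" for \<nu>
    unfolding U_def
  proof (intro small_UN active_small below_small)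
    fix \<alpha>' c' assume "\<alpha>' \<in> active \<alpha> \<nu>" "c' \<in> below \<nu>"
    then have "s \<alpha>' (\<nu>, c') \<in> S \<alpha>'" using prev below_M unfolding levelled_def by blast
    then show "small (s \<alpha>' (\<nu>, c'))" by (rule S_small)
  qed
  have SM: "|M| \<le>o |S \<alpha>|" using S_card ordIso_symmetric ordIso_imp_ordLeq by blast
  have "\<exists>t. inj_on t (M \<times> M) \<and> (\<forall>i\<in>M \<times> M. t i \<in> S \<alpha> - {a \<in> S \<alpha>. a \<inter> U (fst i) \<noteq> {}})"
  proof (rule injective_choice_avoiding)
    show "infinite (S \<alpha>)" using SM M_inf card_of_ordLeq_infinite by blast
    show "|M \<times> M| \<le>o |S \<alpha>|"
      using card_of_Times_same_infinite[OF M_inf] SM ordIso_ordLeq_trans by blast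
    show "|{a \<in> S \<alpha>. a \<inter> U (fst i) \<noteq> {}}| <o |S \<alpha>|" for i
      by (rule ordLess_ordLeq_trans[OF small_less_M SM])
        (rule card_of_members_meeting[OF S_disjoint U])
  qed
  then obtain t where t: "inj_on t (M \<times> M)"
    "\<And>\<nu> c. \<nu> \<in> M \<Longrightarrow> c \<in> M \<Longrightarrow> t (\<nu>, c) \<in> S \<alpha> \<and> t (\<nu>, c) \<inter> U \<nu> = {}" by fastforce
  then have "levelled s \<alpha> t" unfolding levelled_def U_def by blast
  then show "\<exists>t. levelled s \<alpha> t" by blast
qed

text \<open>The level \<open>\<nu>\<close> is the supremum of an \<open>\<omega>\<close>-chain closed under the bounds \<open>G\<close>: levels below \<open>\<nu>\<close>
  lie below some member of the chain and their points were already avoided there, while conflicts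
  on level \<open>\<nu>\<close> itself are excluded by the choice of \<open>s\<close>.\<close>

lemma unconflicted_level:
  assumes s: "\<And>\<alpha>. levelled s \<alpha> (s \<alpha>)"
    and B: "small B" "\<And>\<beta>. \<beta> \<in> B \<Longrightarrow> \<alpha>0 \<in> underS r \<beta>" and c0: "c0 \<in> M"
  shows "\<exists>\<nu>. c0 \<in> below \<nu> \<and> (\<forall>\<beta>\<in>B. \<alpha>0 \<in> active \<beta> \<nu> \<and>
     (\<forall>x\<in>s \<alpha>0 (\<nu>, c0). \<forall>\<alpha> \<nu>' c. \<alpha> \<in> active \<beta> \<nu>' \<and> c \<in> below \<nu>' \<and> x \<in> s \<alpha> (\<nu>', c)
        \<and> (\<nu>' \<in> below \<nu> \<or> \<nu>' = \<nu>) \<longrightarrow> \<alpha> = \<alpha>0 \<and> \<nu>' = \<nu> \<and> c = c0))"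
proof -
  have s_inj: "inj_on (s \<alpha>) (M \<times> M)" for \<alpha> using s unfolding levelled_def by blast
  have s_S: "s \<alpha> (\<nu>, c) \<in> S \<alpha>" if "\<nu> \<in> M" "c \<in> M" for \<alpha> \<nu> c
    using s that unfolding levelled_def by blast
  have s_tie: "s \<alpha> (\<nu>, c) \<inter> s \<alpha>' (\<nu>, c') = {}"
    if "\<nu> \<in> M" "c \<in> M" "\<alpha>' \<in> active \<alpha> \<nu>" "c' \<in> below \<nu>" for \<alpha> \<alpha>' \<nu> c c'
    using s that unfolding levelled_def by blast
  have s_same: "\<nu> = \<nu>' \<and> c = c'" if "\<nu> \<in> M" "c \<in> M" "\<nu>' \<in> M" "c' \<in> M"
    "x \<in> s \<alpha> (\<nu>, c)" "x \<in> s \<alpha> (\<nu>', c')" for \<alpha> \<nu> c \<nu>' c' x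
  proof -
    have "s \<alpha> (\<nu>, c) = s \<alpha> (\<nu>', c')"
      using S_disjoint[of \<alpha>] s_S that unfolding pairwise_def disjnt_def by blast
    then show ?thesis using s_inj[of \<alpha>] that unfolding inj_on_def by blast
  qed
  define Act where "Act \<nu> = (\<Union>\<beta>\<in>B. active \<beta> \<nu>)" for \<nu>
  have Act: "small (Act \<nu>)" for \<nu>
    unfolding Act_def by (intro small_UN active_small B(1))
  define U where "U \<nu> = (\<Union>\<alpha>\<in>Act \<nu>. \<Union>\<nu>'\<in>below \<nu>. \<Union>c\<in>below \<nu>. s \<alpha> (\<nu>', c))" for \<nu>
  have U: "small (U \<nu>)" for \<nu>
    unfolding U_def by (intro small_UN Act below_small) (blast intro: S_small s_S below_M)
  \<comment> \<open>Levels of \<open>\<alpha>0\<close> spoilt by points already placed below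
    \<open>\<nu>\<close>. By disjointness each point of \<open>U \<nu>\<close> spoils at most one
    level.\<close>
  define T where "T \<nu> = {\<nu>' \<in> M. \<exists>c\<in>M. s \<alpha>0 (\<nu>', c) \<inter> U \<nu> \<noteq> {}}" for \<nu>
  have T: "small (T \<nu>)" for \<nu>
  proof (rule small_mono[OF _ small_image[OF U]])
    show "T \<nu> \<subseteq> (\<lambda>x. SOME \<nu>'. \<nu>' \<in> M \<and> (\<exists>c\<in>M. x \<in> s \<alpha>0 (\<nu>', c))) ` U \<nu>"
    proof
      fix \<nu>' assume "\<nu>' \<in> T \<nu>"
      then obtain c x where *: "\<nu>' \<in> M" "c \<in> M" "x \<in> s \<alpha>0 (\<nu>', c)" "x \<in> U \<nu>"
        unfolding T_def by blast
      have "(SOME \<nu>'. \<nu>' \<in> M \<and> (\<exists>c\<in>M. x \<in> s \<alpha>0 (\<nu>', c))) = \<nu>'"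
        by (rule some_equality) (use * s_same in blast)+
      then show "\<nu>' \<in> (\<lambda>x. SOME \<nu>'. \<nu>' \<in> M \<and> (\<exists>c\<in>M. x \<in> s \<alpha>0 (\<nu>', c))) ` U \<nu>"
        using *(4) by (rule image_eqI[OF sym])
    qed
  qed
  \<comment> \<open>Besides the spoilt levels, \<open>H\<close> contains \<open>\<nu>\<close>
    itself, so that the chain increases strictly, and the values of \<open>e\<close> between
    \<open>\<alpha>0\<close> and the active families in both directions, so that the later of two
    families finds the earlier one active at the supremum.\<close>
  define H where "H \<nu> = M \<inter> (below \<nu> \<union> ({\<nu>} \<union> (T \<nu> \<union> (e \<alpha>0 ` Act \<nu> \<union> (\<lambda>\<alpha>. e \<alpha> \<alpha>0) ` Act \<nu>))))" for \<nu>
  have H: "small (H \<nu>)" for \<nu>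
    unfolding H_def
    by (intro small_mono[OF Int_lower2] small_Un below_small T small_image Act small_singleton)
  have "H \<nu> \<subseteq> M" for \<nu> unfolding H_def by blast
  from below_bounded[OF this H]
  have "\<forall>\<nu>. \<exists>\<nu>'. \<nu>' \<in> M \<and> H \<nu> \<subseteq> below \<nu>'" by blast
  then obtain G where G: "\<And>\<nu>. G \<nu> \<in> M" "\<And>\<nu>. H \<nu> \<subseteq> below (G \<nu>)" by metis
  have "\<exists>\<nu>\<in>M. {c0} \<union> (\<lambda>\<beta>. e \<beta> \<alpha>0) ` B \<subseteq> below \<nu>"
    by (rule below_bounded) (use c0 e_M B(2) in blast, intro small_Un small_image B(1) small_singleton)
  then obtain \<nu>0 where \<nu>0: "\<nu>0 \<in> M" "c0 \<in> below \<nu>0" "\<And>\<beta>. \<beta> \<in> B \<Longrightarrow> e \<beta> \<alpha>0 \<in> below \<nu>0"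
    by auto
  define N where "N = rec_nat \<nu>0 (\<lambda>_. G)"
  have N: "N 0 = \<nu>0" "\<And>n. N (Suc n) = G (N n)" by (simp_all add: N_def)
  have N_M: "N n \<in> M" for n by (cases n) (simp_all add: N \<nu>0(1) G(1))
  have N_Suc: "H (N n) \<subseteq> below (N (Suc n))" for n using G(2) N(2) by simp
  have "\<exists>\<nu>\<in>M. range N \<subseteq> below \<nu>"
    by (rule below_bounded[OF _ small_range_nat]) (use N_M in blast)
  then obtain \<nu>1 where \<nu>1: "\<nu>1 \<in> {\<nu>\<in>M. range N \<subseteq> below \<nu>}" by blast
  obtain \<nu> where mem: "\<nu> \<in> {\<nu>\<in>M. range N \<subseteq> below \<nu>}"
    and min: "\<And>y. (y, \<nu>) \<in> |M| - Id \<Longrightarrow> y \<notin> {\<nu>\<in>M. range N \<subseteq> below \<nu>}"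
    by (rule wfE_min[OF woM.WF \<nu>1]) (rule that)
  have \<nu>: "\<nu> \<in> M" "range N \<subseteq> below \<nu>" using mem by simp_all
  have cof: "\<exists>n. y \<in> below (N n)" if y: "y \<in> below \<nu>" for y
  proof -
    have "\<not> range N \<subseteq> below y" using min[of y] y below_M(1)[OF y] unfolding underS_def by blast
    then obtain n where n: "N n \<notin> below y" by blast
    then have "y \<in> below (N n) \<or> y = N n" using below_cases[OF below_M(1)[OF y] N_M] by blast
    then have "y \<in> H (N n)" using below_M(1)[OF y] unfolding H_def by blast
    then show ?thesis using N_Suc by blast
  qed
  have c0\<nu>: "c0 \<in> below \<nu>" using below_trans[OF \<nu>0(2)] \<nu>(2) N(1) by (metis rangeI subsetD)
  show ?thesis
  proof (intro exI[of _ \<nu>] conjI ballI allI impI c0\<nu>)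
    fix \<beta> assume \<beta>: "\<beta> \<in> B"
    show "\<alpha>0 \<in> active \<beta> \<nu>"
      using B(2)[OF \<beta>] below_trans[OF \<nu>0(3)[OF \<beta>]] \<nu>(2) N(1) unfolding active_def
      by (metis (mono_tags, lifting) mem_Collect_eq rangeI subsetD)
    fix x \<alpha> \<nu>' c assume x: "x \<in> s \<alpha>0 (\<nu>, c0)"
      and asm: "\<alpha> \<in> active \<beta> \<nu>' \<and> c \<in> below \<nu>' \<and> x \<in> s \<alpha> (\<nu>', c) \<and> (\<nu>' \<in> below \<nu> \<or> \<nu>' = \<nu>)"
    \<comment> \<open>Such a conflict would show up at some stage \<open>N n\<close> and put
      \<open>\<nu>\<close> into \<open>T (N n)\<close>, hence below \<open>N (Suc n)\<close>, which
      itself lies below \<open>\<nu>\<close>.\<close>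
    have "\<nu>' \<notin> below \<nu>"
    proof
      assume "\<nu>' \<in> below \<nu>"
      then obtain n where n: "\<nu>' \<in> below (N n)" using cof by blast
      have "\<alpha> \<in> active \<beta> (N n)" using asm below_trans[OF _ n] unfolding active_def by blast
      moreover have "c \<in> below (N n)" using asm below_trans[OF _ n] by blast
      ultimately have "x \<in> U (N n)" using \<beta> n asm unfolding U_def Act_def by blast
      then have "\<nu> \<in> H (N n)" using x \<nu>(1) c0 unfolding T_def H_def by blast
      then have "\<nu> \<in> below (N (Suc n))" using N_Suc by blast
      moreover have "N (Suc n) \<in> below \<nu>" using \<nu>(2) by blast
      ultimately have "\<nu> \<in> below \<nu>" by (rule below_trans)
      then show False by (simp add: underS_def)
    qed
    then have \<nu>': "\<nu>' = \<nu>" using asm by blast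
    have "\<alpha> = \<alpha>0"
    proof (rule ccontr)
      assume ne: "\<alpha> \<noteq> \<alpha>0"
      have "e \<beta> \<alpha> \<in> below \<nu>" using asm \<nu>' unfolding active_def by blast
      then obtain n where "e \<beta> \<alpha> \<in> below (N n)" using cof by blast
      then have Acn: "\<alpha> \<in> Act (N n)" using asm \<beta> unfolding Act_def active_def by blast
      have up: "y \<in> below \<nu>" if "y \<in> M" "y \<in> e \<alpha>0 ` Act (N n) \<union> (\<lambda>\<alpha>. e \<alpha> \<alpha>0) ` Act (N n)" for y
      proof (rule below_trans[of _ "N (Suc n)"])
        show "y \<in> below (N (Suc n))" using N_Suc[of n] that unfolding H_def by blast
        show "N (Suc n) \<in> below \<nu>" using \<nu>(2) by blast
      qed
      consider "\<alpha> \<in> underS r \<alpha>0" | "\<alpha>0 \<in> underS r \<alpha>" using underS_cases ne by blast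
      then show False
      proof cases
        case 1
        then have "\<alpha> \<in> active \<alpha>0 \<nu>" using up[OF e_M[OF 1]] Acn unfolding active_def by blast
        from s_tie[OF \<nu>(1) c0 this, of c] show False using asm \<nu>' x by blast
      next
        case 2
        then have act: "\<alpha>0 \<in> active \<alpha> \<nu>" using up[OF e_M[OF 2]] Acn unfolding active_def by blast
        have "c \<in> M" using asm below_M(1) by blast
        from s_tie[OF \<nu>(1) this act c0\<nu>] show False using asm \<nu>' x by blast
      qed
    qed
    moreover have "c = c0"
    proof -
      have "c \<in> M" using asm below_M(1) by blast
      moreover have "x \<in> s \<alpha>0 (\<nu>, c)" using asm \<nu>' \<open>\<alpha> = \<alpha>0\<close> by blast
      ultimately show ?thesis using s_same[OF \<nu>(1) _ \<nu>(1) c0 _ x] by blast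
    qed
    ultimately show "\<alpha> = \<alpha>0" "\<nu>' = \<nu>" "c = c0" using \<nu>' by blast+
  qed
qed

end

text \<open>The inverse of \<open>ord_el\<close>: the colouring is given only a point and has to
  recover the row index from the member that contains it.\<close>

definition position :: "'a rel \<Rightarrow> 'a set \<Rightarrow> 'a \<Rightarrow> 'a" where
  "position r a x = (THE i. Restr r {y \<in> a. (y, x) \<in> r \<and> y \<noteq> x} =o Restr r (underS r i))"

lemma position_ord_el:
  assumes r: "Well_order r" "Field r = UNIV"
    and a: "Restr r a =o Restr r (underS r \<xi>)" and i: "i \<in> underS r \<xi>"
  shows "position r a (ord_el r a i) = i"
  unfolding position_def
proof (rule the_equality)
  note iso = ord_el_props(2)[OF r a i]
  show "Restr r {y \<in> a. (y, ord_el r a i) \<in> r \<and> y \<noteq> ord_el r a i} =o Restr r (underS r i)"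
    by (rule iso)
  fix j assume "Restr r {y \<in> a. (y, ord_el r a i) \<in> r \<and> y \<noteq> ord_el r a i} =o Restr r (underS r j)"
  from ordIso_transitive[OF ordIso_symmetric[OF this] iso] show "j = i"
    by (rule Restr_underS_inject[OF r(1), rotated 2]) (simp_all add: r(2))
qed

section \<open>What a column reads off a point\<close>

context disjoint_families
begin

definition reads :: "('a \<Rightarrow> 'a \<times> 'a \<Rightarrow> 'a set) \<Rightarrow> 'a \<Rightarrow> 'a \<Rightarrow> 'a \<times> 'a \<times> 'a \<Rightarrow> bool" where
  "reads s \<beta> x = (\<lambda>(\<alpha>, \<nu>, c). \<alpha> \<in> active \<beta> \<nu> \<and> c \<in> below \<nu> \<and> x \<in> s \<alpha> (\<nu>, c))"

text \<open>Ties on the lowest level, and points read nowhere, are left to the arbitrary choice of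
  \<open>SOME\<close>; the points used later have exactly one reading up to their level.\<close>

definition reading :: "('a \<Rightarrow> 'a \<times> 'a \<Rightarrow> 'a set) \<Rightarrow> 'a \<Rightarrow> 'a \<Rightarrow> 'a \<times> 'a \<times> 'a" where
  "reading s \<beta> x = (SOME q. reads s \<beta> x q \<and>
     (\<forall>q'. reads s \<beta> x q' \<longrightarrow> fst (snd q') \<notin> below (fst (snd q))))"

text \<open>On the level from \<open>unconflicted_level\<close> the prescribed triple is a reading,
  and there is no other one on that level or below, so the minimal choice must be this one.\<close>

lemma ex_common_reading:
  assumes s: "\<And>\<alpha>. levelled s \<alpha> (s \<alpha>)"
    and B: "small B" "\<And>\<beta>. \<beta> \<in> B \<Longrightarrow> \<alpha>0 \<in> underS r \<beta>" and c0: "c0 \<in> M"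
  shows "\<exists>\<nu>\<in>M. \<forall>\<beta>\<in>B. \<forall>x\<in>s \<alpha>0 (\<nu>, c0). reading s \<beta> x = (\<alpha>0, \<nu>, c0)"
proof -
  obtain \<nu> where \<nu>: "c0 \<in> below \<nu>"
    and all: "\<forall>\<beta>\<in>B. \<alpha>0 \<in> active \<beta> \<nu> \<and>
     (\<forall>x\<in>s \<alpha>0 (\<nu>, c0). \<forall>\<alpha> \<nu>' c. \<alpha> \<in> active \<beta> \<nu>' \<and> c \<in> below \<nu>' \<and> x \<in> s \<alpha> (\<nu>', c)
        \<and> (\<nu>' \<in> below \<nu> \<or> \<nu>' = \<nu>) \<longrightarrow> \<alpha> = \<alpha>0 \<and> \<nu>' = \<nu> \<and> c = c0)"
    using unconflicted_level[of s B \<alpha>0 c0] s B c0 by metis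
  have act: "\<alpha>0 \<in> active \<beta> \<nu>" if "\<beta> \<in> B" for \<beta> using all that by blast
  have uniq: "(\<alpha>, \<nu>', c) = (\<alpha>0, \<nu>, c0)"
    if "\<beta> \<in> B" "x \<in> s \<alpha>0 (\<nu>, c0)" "reads s \<beta> x (\<alpha>, \<nu>', c)" "\<nu>' \<in> below \<nu> \<or> \<nu>' = \<nu>"
    for \<beta> x \<alpha> \<nu>' c
    using bspec[OF bspec[OF all that(1), THEN conjunct2] that(2)] that(3,4)
    unfolding reads_def prod.case prod.inject by blast
  have irr: "\<nu> \<notin> below \<nu>" by (simp add: underS_def)
  have "reading s \<beta> x = (\<alpha>0, \<nu>, c0)" if \<beta>: "\<beta> \<in> B" and x: "x \<in> s \<alpha>0 (\<nu>, c0)" for \<beta> x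
    unfolding reading_def
  proof (rule some_equality)
    have rd: "reads s \<beta> x (\<alpha>0, \<nu>, c0)" using act[OF \<beta>] \<nu> x by (simp add: reads_def)
    show "reads s \<beta> x (\<alpha>0, \<nu>, c0) \<and>
      (\<forall>q'. reads s \<beta> x q' \<longrightarrow> fst (snd q') \<notin> below (fst (snd (\<alpha>0, \<nu>, c0))))"
    proof (intro conjI allI impI notI rd)
      fix q' assume q': "reads s \<beta> x q'" "fst (snd q') \<in> below (fst (snd (\<alpha>0, \<nu>, c0)))"
      obtain \<alpha> \<nu>' c where [simp]: "q' = (\<alpha>, \<nu>', c)" by (cases q')
      show False using uniq[OF \<beta> x, of \<alpha> \<nu>' c] q' irr by simp
    qed
    fix q assume q: "reads s \<beta> x q \<and>
      (\<forall>q'. reads s \<beta> x q' \<longrightarrow> fst (snd q') \<notin> below (fst (snd q)))"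
    obtain \<alpha> \<nu>' c where [simp]: "q = (\<alpha>, \<nu>', c)" by (cases q)
    have "\<nu> \<notin> below \<nu>'" using q rd by fastforce
    moreover have "\<nu>' \<in> M" using q below_M(2) by (auto simp: reads_def)
    ultimately have "\<nu>' \<in> below \<nu> \<or> \<nu>' = \<nu>" using below_cases[OF _ below_M(2)[OF \<nu>]] by blast
    then show "q = (\<alpha>0, \<nu>, c0)" using uniq[OF \<beta> x, of \<alpha> \<nu>' c] q by simp
  qed
  then show ?thesis using below_M(2)[OF \<nu>] by blast
qed

end

section \<open>Counting under GCH: enumerations of families, colours and codes\<close>

context double_successor
begin

lemma UNIV_r: "|UNIV :: 'a set| =o r"
  by (rule ordIso_symmetric[OF card_of_unique[OF r]])

lemma cardSuc_M_infinite_card: "Card_order (cardSuc |M| )" "infinite (Field (cardSuc |M| ))"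
  by (rule cardSuc_Card_order[OF card_of_Card_order]) (rule Field_cardSuc_infinite[OF M_inf])

lemma UNIV_le: "|UNIV :: 'a set| \<le>o cardSuc |M|"
  by (rule ordIso_imp_ordLeq[OF ordIso_transitive[OF UNIV_r rM]])

lemma surj_from_r:
  assumes "|F| \<le>o cardSuc |M|" "F \<noteq> {}"
  shows "\<exists>g :: 'a \<Rightarrow> 'b. range g = F"
proof -
  have "|F| \<le>o |UNIV :: 'a set|"
    by (rule ordLeq_ordIso_trans[OF assms(1)
          ordIso_symmetric[OF ordIso_transitive[OF UNIV_r rM]]])
  then show ?thesis by (rule card_of_ordLeq2[OF assms(2), THEN iffD2])
qed

text \<open>\<open>\<lambda>\<^sup>\<mu> = \<lambda>\<close> is applied twice, first to sets of
  ordinals and then to families of them.\<close>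

lemma ex_enumeration_families:
  assumes GCH_M: "|Pow M| =o cardSuc |M|"
  shows "\<exists>S :: 'a \<Rightarrow> 'a set set. range S = {F. |F| =o |M| \<and> pairwise disjnt F \<and> (\<forall>a\<in>F. small a)}"
    (is "\<exists>S. range S = ?X")
proof (rule surj_from_r)
  let ?Q = "{a :: 'a set. a \<subseteq> UNIV \<and> |a| \<le>o |M|}"
  have Q: "|?Q| \<le>o cardSuc |M|" by (rule card_of_small_subsets[OF M_inf GCH_M UNIV_le])
  have sub: "?X \<subseteq> {F. F \<subseteq> ?Q \<and> |F| \<le>o |M|}"
    using small_le_M ordIso_imp_ordLeq by blast
  show "|?X| \<le>o cardSuc |M|"
    by (rule ordLeq_transitive[OF card_of_mono1[OF sub] card_of_small_subsets[OF M_inf GCH_M Q]])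
  have "|(\<lambda>x. {x}) ` M| =o |M|"
    by (rule ordIso_symmetric, rule card_of_ordIsoI[of "\<lambda>x. {x}"]) (simp add: bij_betw_def inj_on_def)
  moreover have "pairwise disjnt ((\<lambda>x. {x}) ` M)" by (auto simp: pairwise_def disjnt_def)
  moreover have "\<forall>a\<in>(\<lambda>x. {x}) ` M. small a" by (auto intro: small_singleton)
  ultimately have "(\<lambda>x. {x}) ` M \<in> ?X" by blast
  then show "?X \<noteq> {}" by blast
qed

text \<open>These sets decode colours: a triple \<open>(\<delta>, t, w)\<close> will mean that the
  value \<open>t\<close> of \<open>p \<delta>\<close> is sent to \<open>w\<close>.\<close>

lemma ex_enumeration_graphs:
  assumes GCH_M: "|Pow M| =o cardSuc |M|"
  shows "\<exists>D :: 'a \<Rightarrow> ('a \<times> 'a \<times> 'a) set. range D = {G. |G| \<le>o |M|}"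
proof (rule surj_from_r)
  have "|UNIV \<times> UNIV \<times> UNIV :: ('a \<times> 'a \<times> 'a) set| \<le>o cardSuc |M|"
    by (intro card_of_Times_ordLeq_infinite_Field UNIV_le cardSuc_M_infinite_card)
  then have "|UNIV :: ('a \<times> 'a \<times> 'a) set| \<le>o cardSuc |M|" by simp
  from card_of_small_subsets[OF M_inf GCH_M this]
  show "|{G :: ('a \<times> 'a \<times> 'a) set. |G| \<le>o |M|}| \<le>o cardSuc |M|" by simp
  show "{G :: ('a \<times> 'a \<times> 'a) set. |G| \<le>o |M|} \<noteq> {}"
    using card_of_empty by blast
qed

text \<open>An entry \<open>(i, Y, Z, v)\<close> instructs every column \<open>\<beta>\<close> with \<open>X \<beta> \<inter> Y = Z\<close> to give the value
  coded by \<open>v\<close> to the point in position \<open>i\<close>.\<close>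

definition code_entries :: "('a \<times> 'a set \<times> 'a set \<times> 'a) set" where
  "code_entries = K \<times> {Y. Y \<subseteq> M \<and> small Y} \<times> {Y. Y \<subseteq> M \<and> small Y} \<times> M"

text \<open>\<open>\<mu>\<^sup>\<kappa> = \<mu>\<close>, used for the sets \<open>Y\<close>,
  \<open>Z\<close> and then again for small sets of entries.\<close>

lemma ex_enumeration_codes:
  assumes GCH_K: "|Pow K| =o cardSuc |K|"
  shows "\<exists>dec. dec ` M = {C. C \<subseteq> code_entries \<and> small C}"
proof -
  have M_le: "|M| \<le>o cardSuc |K|" by (rule ordIso_imp_ordLeq[OF M])
  have "|code_entries| \<le>o cardSuc |K|"
    unfolding code_entries_def
    by (intro card_of_Times_ordLeq_infinite_Field card_of_small_subsets[OF K_inf GCH_K M_le] M_le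
        Field_cardSuc_infinite[OF K_inf] cardSuc_Card_order card_of_Card_order cardSuc_ordLeq)
  from card_of_small_subsets[OF K_inf GCH_K this]
  have "|{C. C \<subseteq> code_entries \<and> small C}| \<le>o |M|"
    by (rule ordLeq_ordIso_trans[OF _ ordIso_symmetric[OF M]])
  moreover have "{C. C \<subseteq> code_entries \<and> small C} \<noteq> {}" using card_of_empty by blast
  ultimately show ?thesis by (intro card_of_ordLeq2[THEN iffD2])
qed

text \<open>\<open>\<lambda> = \<mu>\<^sup>+ \<le> 2\<^sup>\<mu>\<close>, so columns can be named by
  distinct subsets of \<open>M\<close>.\<close>

lemma ex_inj_subsets: "\<exists>X :: 'a \<Rightarrow> 'a set. inj X \<and> (\<forall>\<beta>. X \<beta> \<subseteq> M)"
proof -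
  have "cardSuc |M| \<le>o |Pow M|"
    by (rule cardSuc_least[OF card_of_Card_order card_of_Card_order card_of_Pow])
  from ordLeq_transitive[OF UNIV_le this] obtain X :: "'a \<Rightarrow> 'a set"
    where "inj X" "range X \<subseteq> Pow M" using card_of_ordLeq[of UNIV "Pow M"] by auto
  then show ?thesis by blast
qed

lemma ex_inj_initial_segments: "\<exists>e. \<forall>\<beta>. inj_on (e \<beta>) (underS r \<beta>) \<and> e \<beta> ` underS r \<beta> \<subseteq> M"
proof (rule choice, rule allI)
  fix \<beta>
  have "Card_order r" using card_order_on_Card_order[OF r] by blast
  from cardSuc_underS_small[OF this rM, of \<beta>]
  show "\<exists>f. inj_on f (underS r \<beta>) \<and> f ` underS r \<beta> \<subseteq> M" by (rule card_of_ordLeq[THEN iffD2])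
qed

text \<open>\<open>Y\<close> collects one distinguishing element for each pair from
  \<open>b\<close>. Its traces let an instruction single out one column among those in
  \<open>b\<close>.\<close>

lemma ex_small_separating_set:
  fixes X :: "'a \<Rightarrow> 'a set"
  assumes X: "inj X" "\<And>\<beta>. X \<beta> \<subseteq> M" and b: "small b"
  shows "\<exists>Y. Y \<subseteq> M \<and> small Y \<and> inj_on (\<lambda>\<beta>. X \<beta> \<inter> Y) b"
proof -
  have "\<exists>d. \<beta> \<noteq> \<beta>' \<longrightarrow> d \<in> M \<and> (d \<in> X \<beta>) \<noteq> (d \<in> X \<beta>')" for \<beta> \<beta>'
    using injD[OF X(1), of \<beta> \<beta>'] X(2) by blast
  then obtain d where d: "\<And>\<beta> \<beta>'. \<beta> \<noteq> \<beta>' \<Longrightarrow> d \<beta> \<beta>' \<in> M \<and> (d \<beta> \<beta>' \<in> X \<beta>) \<noteq> (d \<beta> \<beta>' \<in> X \<beta>')"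
    by metis
  let ?Y = "M \<inter> (\<lambda>(\<beta>, \<beta>'). d \<beta> \<beta>') ` (b \<times> b)"
  have "small ?Y" by (intro small_mono[OF Int_lower2] small_image small_Times b)
  moreover have "inj_on (\<lambda>\<beta>. X \<beta> \<inter> ?Y) b"
  proof (rule inj_onI, rule ccontr)
    fix \<beta> \<beta>' assume *: "\<beta> \<in> b" "\<beta>' \<in> b" "X \<beta> \<inter> ?Y = X \<beta>' \<inter> ?Y" "\<beta> \<noteq> \<beta>'"
    have "d \<beta> \<beta>' \<in> ?Y" using d[OF *(4)] *(1,2) by auto
    then show False using d[OF *(4)] *(3) by blast
  qed
  ultimately show ?thesis by blast
qed

section \<open>The colouring and its verification\<close>

lemma Restr_iso_small:
  assumes "Restr r a =o Restr r (underS r \<xi>)" "small (underS r \<xi>)"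
  shows "small a"
proof -
  have F: "Field (Restr r c) = c" for c using Refl_Field_Restr2[OF wo.REFL] Field_r by simp
  show ?thesis
    using card_of_mono2[OF ordIso_imp_ordLeq[OF assms(1)]] unfolding F
    by (rule ordLeq_transitive[OF _ assms(2)])
qed

text \<open>\<open>P\<close> is bounded by some \<open>\<gamma>\<close>, and at most
  \<open>|M|\<close> members of a disjoint family meet the segment below \<open>\<gamma>\<close>,
  while \<open>A\<close> has more.\<close>

lemma ex_member_above:
  assumes A: "|A| =o r" "pairwise disjnt A" and P: "|P| \<le>o |M|"
  shows "\<exists>b\<in>A. \<forall>y\<in>b. P \<subseteq> underS r y"
proof -
  obtain \<gamma> where \<gamma>: "P \<subseteq> underS r \<gamma>" using r_bounded[OF P] by blast
  have Cr: "Card_order r" using card_order_on_Card_order[OF r] by blast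
  have le: "|{a \<in> A. a \<inter> underS r \<gamma> \<noteq> {}}| \<le>o |M|"
    by (rule card_of_members_meeting[OF A(2) cardSuc_underS_small[OF Cr rM]])
  have "|M| <o |A|"
    by (rule ordLess_ordIso_trans[OF cardSuc_greater[OF card_of_Card_order]
          ordIso_symmetric[OF ordIso_transitive[OF A(1) rM]]])
  then have "|{a \<in> A. a \<inter> underS r \<gamma> \<noteq> {}}| <o |A|" by (rule ordLeq_ordLess_trans[OF le])
  then have "\<not> A \<subseteq> {a \<in> A. a \<inter> underS r \<gamma> \<noteq> {}}"
    using card_of_mono1 not_ordLess_ordLeq by blast
  then obtain b where b: "b \<in> A" "b \<inter> underS r \<gamma> = {}" by blast
  have "P \<subseteq> underS r y" if "y \<in> b" for y
  proof -
    have "y \<notin> underS r \<gamma>" using b(2) that by blast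
    then have "y = \<gamma> \<or> (\<gamma>, y) \<in> r" using underS_cases[of y \<gamma>] unfolding underS_def by blast
    then show ?thesis using \<gamma> underS_incr[OF wo.TRANS wo.ANTISYM, of \<gamma> y] by blast
  qed
  then show ?thesis using b(1) by blast
qed

text \<open>The matrix is coded relative to the columns in \<open>b\<close>, so \<open>b\<close> is
  fixed first; \<open>a\<close> is then found in a subfamily of size \<open>\<mu>\<close> lying
  entirely below \<open>b\<close>, on a level where it carries that code.\<close>

lemma Pr0_seq_if_GCH:
  assumes GCH_K: "|Pow K| =o cardSuc |K|" and GCH_M: "|Pow M| =o cardSuc |M|"
    and k: "K = underS r k"
    and \<theta>: "\<And>\<delta>. |underS r (\<theta> \<delta>)| \<le>o |M|"
    and p: "\<And>\<delta> x y. x \<in> underS r y \<Longrightarrow> p \<delta> x y \<in> underS r (\<theta> \<delta>)"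
  shows "Pr0_seq r k p"
proof -
  obtain S :: "'a \<Rightarrow> 'a set set"
    where S: "range S = {F. |F| =o |M| \<and> pairwise disjnt F \<and> (\<forall>a\<in>F. small a)}"
    using ex_enumeration_families[OF GCH_M] by blast
  obtain D :: "'a \<Rightarrow> ('a \<times> 'a \<times> 'a) set" where D: "range D = {G. |G| \<le>o |M|}"
    using ex_enumeration_graphs[OF GCH_M] by blast
  obtain dec where dec: "dec ` M = {C. C \<subseteq> code_entries \<and> small C}"
    using ex_enumeration_codes[OF GCH_K] by blast
  obtain X :: "'a \<Rightarrow> 'a set" where X: "inj X" "\<And>\<beta>. X \<beta> \<subseteq> M"
    using ex_inj_subsets by blast
  obtain e where e: "\<And>\<beta>. inj_on (e \<beta>) (underS r \<beta>)" "\<And>\<beta>. e \<beta> ` underS r \<beta> \<subseteq> M"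
    using ex_inj_initial_segments by blast
  have SX: "S \<alpha> \<in> {F. |F| =o |M| \<and> pairwise disjnt F \<and> (\<forall>a\<in>F. small a)}" for \<alpha>
    unfolding S[symmetric] by (rule rangeI)
  interpret disjoint_families r K M e S
    by unfold_locales (use SX e in blast)+
  obtain s where s: "\<And>\<alpha>. levelled s \<alpha> (s \<alpha>)" using ex_levelled by blast
  have wr: "Well_order r" by (rule wo.WELL)
  \<comment> \<open>An entry stores \<open>v\<close> in \<open>M\<close>, since there are too many
    colour indices \<open>y\<close> for a code; column \<open>\<beta>\<close> recovers
    \<open>y\<close> by inverting its own \<open>e \<beta>\<close>. The tag \<open>\<delta>\<close>
    inside \<open>D y\<close> tells \<open>f\<close> which partition is meant.\<close>
  define f where "f x \<beta> = (case reading s \<beta> x of (\<alpha>, \<nu>, c) \<Rightarrow>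
    let i = position r (s \<alpha> (\<nu>, c)) x;
        v = SOME v. \<exists>Y. (i, Y, X \<beta> \<inter> Y, v) \<in> dec c;
        y = inv_into (underS r \<beta>) (e \<beta>) v
    in SOME w. \<exists>\<delta>. (\<delta>, p \<delta> x \<beta>, w) \<in> D y)" for x \<beta>
  have main: "\<exists>a\<in>A. \<exists>b\<in>A. (\<forall>x\<in>a. \<forall>y\<in>b. (x, y) \<in> r \<and> x \<noteq> y) \<and>
      (\<forall>i\<in>underS r \<xi>. \<forall>j\<in>underS r \<xi>.
        f (ord_el r a i) (ord_el r b j) = \<zeta> i j (p \<delta> (ord_el r a i) (ord_el r b j)))"
    if \<xi>: "\<xi> \<in> underS r k" and iso: "\<And>a. a \<in> A \<Longrightarrow> Restr r a =o Restr r (underS r \<xi>)"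
      and disj: "pairwise disjnt A" and card: "|A| =o r"
    for \<delta> \<xi> A and \<zeta> :: "'a \<Rightarrow> 'a \<Rightarrow> 'a \<Rightarrow> 'a"
  proof -
    have \<xi>K: "underS r \<xi> \<subseteq> K"
      using \<xi> underS_incr[OF wo.TRANS wo.ANTISYM, of \<xi> k] unfolding k underS_def by blast
    then have \<xi>s: "small (underS r \<xi>)" by (rule card_of_mono1)
    have A_small: "small a" if "a \<in> A" for a by (rule Restr_iso_small[OF iso[OF that] \<xi>s])
    have "|M| \<le>o |A|"
      by (rule ordLess_imp_ordLeq[OF ordLess_ordIso_trans[OF cardSuc_greater[OF card_of_Card_order]
            ordIso_symmetric[OF ordIso_transitive[OF card rM]]]])
    then obtain F where F: "F \<subseteq> A" "|M| =o |F|"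
      using internalize_card_of_ordLeq2[of M A] by blast
    have "F \<in> range S"
      unfolding S using F(1) ordIso_symmetric[OF F(2)] pairwise_subset[OF disj F(1)] A_small by blast
    then obtain \<alpha>0 where \<alpha>0: "S \<alpha>0 = F" by blast
    \<comment> \<open>Restricting to the range of \<open>p \<delta>\<close> keeps the graph of size
      at most \<open>|M|\<close>, as \<open>D\<close> requires.\<close>
    have "\<exists>y. D y = (\<lambda>t. (\<delta>, t, \<zeta> i j t)) ` underS r (\<theta> \<delta>)" for i j
    proof -
      have "(\<lambda>t. (\<delta>, t, \<zeta> i j t)) ` underS r (\<theta> \<delta>) \<in> range D"
        unfolding D by (rule CollectI, rule ordLeq_transitive[OF card_of_image \<theta>])
      then show ?thesis by (metis rangeE)
    qed
    then obtain y where y: "\<And>i j. D (y i j) = (\<lambda>t. (\<delta>, t, \<zeta> i j t)) ` underS r (\<theta> \<delta>)" by metis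
    \<comment> \<open>\<open>b\<close> must lie beyond the points of \<open>F\<close>, so that
      \<open>a\<close> precedes it, beyond \<open>\<alpha>0\<close>, so that its columns see the
      family, and beyond all \<open>y i j\<close>, so that \<open>e \<beta>\<close> can code
      them.\<close>
    define P where "P = \<Union>F \<union> ({\<alpha>0} \<union> (\<lambda>(i, j). y i j) ` (underS r \<xi> \<times> underS r \<xi>))"
    have P1: "|\<Union>F| \<le>o |M|"
      using card_of_UNION_ordLeq_infinite[OF M_inf ordIso_imp_ordLeq[OF ordIso_symmetric[OF F(2)]],
          of "\<lambda>a. a"] small_le_M[OF A_small] F(1) by auto
    have P2: "small ({\<alpha>0} \<union> (\<lambda>(i, j). y i j) ` (underS r \<xi> \<times> underS r \<xi>))"
      by (intro small_Un small_singleton small_image small_Times \<xi>s)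
    have "|P| \<le>o |M|"
      unfolding P_def by (rule card_of_Un_ordLeq_infinite_Field[OF _ P1 small_le_M[OF P2]])
        (simp_all add: Field_card_of M_inf card_of_card_order_on)
    then obtain b where b: "b \<in> A" "\<And>\<beta>. \<beta> \<in> b \<Longrightarrow> P \<subseteq> underS r \<beta>"
      using ex_member_above[OF card disj] by blast
    obtain Y where Y: "Y \<subseteq> M" "small Y" "inj_on (\<lambda>\<beta>. X \<beta> \<inter> Y) b"
      using ex_small_separating_set[OF X A_small[OF b(1)]] by blast
    have bj: "ord_el r b j \<in> b" if "j \<in> underS r \<xi>" for j
      by (rule ord_el_props(1)[OF wr Field_r iso[OF b(1)] that])
    have bpos: "position r b (ord_el r b j) = j" if "j \<in> underS r \<xi>" for j
      by (rule position_ord_el[OF wr Field_r iso[OF b(1)] that])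
    have yb: "y i j \<in> underS r (ord_el r b j')"
      if "i \<in> underS r \<xi>" "j \<in> underS r \<xi>" "j' \<in> underS r \<xi>" for i j j'
      using b(2)[OF bj[OF that(3)]] that(1,2) unfolding P_def by auto
    define C where "C = (\<lambda>(i, j). (i, Y, X (ord_el r b j) \<inter> Y, e (ord_el r b j) (y i j))) `
      (underS r \<xi> \<times> underS r \<xi>)"
    have "C \<subseteq> code_entries"
    proof
      fix q assume "q \<in> C"
      then obtain i j where ij: "i \<in> underS r \<xi>" "j \<in> underS r \<xi>"
        and q: "q = (i, Y, X (ord_el r b j) \<inter> Y, e (ord_el r b j) (y i j))" unfolding C_def by auto
      have "small (X (ord_el r b j) \<inter> Y)" by (rule small_mono[OF Int_lower2 Y(2)])
      moreover have "e (ord_el r b j) (y i j) \<in> M" by (rule e_M[OF yb[OF ij ij(2)]])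
      ultimately show "q \<in> code_entries" unfolding q code_entries_def using ij \<xi>K Y(1,2) by blast
    qed
    moreover have "small C" unfolding C_def by (intro small_image small_Times \<xi>s)
    ultimately have "C \<in> dec ` M" unfolding dec by blast
    then obtain c0 where c0: "c0 \<in> M" "dec c0 = C" by blast
    have \<alpha>b: "\<alpha>0 \<in> underS r \<beta>" if "\<beta> \<in> b" for \<beta> using b(2)[OF that] unfolding P_def by blast
    obtain \<nu> where \<nu>: "\<nu> \<in> M"
      and rd: "\<And>\<beta> x. \<beta> \<in> b \<Longrightarrow> x \<in> s \<alpha>0 (\<nu>, c0) \<Longrightarrow> reading s \<beta> x = (\<alpha>0, \<nu>, c0)"
      using ex_common_reading[OF s A_small[OF b(1)] \<alpha>b c0(1)] by blast
    define a where "a = s \<alpha>0 (\<nu>, c0)"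
    have aF: "a \<in> F" using s[of \<alpha>0] \<nu> c0(1) unfolding levelled_def a_def \<alpha>0 by blast
    then have aA: "a \<in> A" using F(1) by blast
    have ab: "x \<in> underS r \<beta>" if "x \<in> a" "\<beta> \<in> b" for x \<beta>
      using b(2)[OF that(2)] aF that(1) unfolding P_def by blast
    have "f (ord_el r a i) (ord_el r b j) = \<zeta> i j (p \<delta> (ord_el r a i) (ord_el r b j))"
      if ij: "i \<in> underS r \<xi>" "j \<in> underS r \<xi>" for i j
    proof -
      let ?x = "ord_el r a i" and ?\<beta> = "ord_el r b j"
      have x: "?x \<in> a" by (rule ord_el_props(1)[OF wr Field_r iso[OF aA] ij(1)])
      have pos: "position r a ?x = i" by (rule position_ord_el[OF wr Field_r iso[OF aA] ij(1)])
      \<comment> \<open>All entries of \<open>C\<close> share the same \<open>Y\<close>, whose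
        traces separate \<open>b\<close>; so an entry that matches is meant for the
        \<open>j\<close>-th column itself.\<close>
      have v: "(SOME v. \<exists>Y'. (i, Y', X ?\<beta> \<inter> Y', v) \<in> C) = e ?\<beta> (y i j)"
      proof (rule some_equality)
        show "\<exists>Y'. (i, Y', X ?\<beta> \<inter> Y', e ?\<beta> (y i j)) \<in> C" using ij unfolding C_def by force
        fix v assume "\<exists>Y'. (i, Y', X ?\<beta> \<inter> Y', v) \<in> C"
        then obtain j' where j': "j' \<in> underS r \<xi>" "X ?\<beta> \<inter> Y = X (ord_el r b j') \<inter> Y"
          "v = e (ord_el r b j') (y i j')" unfolding C_def by auto
        have "ord_el r b j = ord_el r b j'" by (rule inj_onD[OF Y(3) j'(2) bj[OF ij(2)] bj[OF j'(1)]])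
        from arg_cong[OF this, of "position r b"] have "j = j'"
          unfolding bpos[OF ij(2)] bpos[OF j'(1)] .
        with j'(3) show "v = e ?\<beta> (y i j)" by blast
      qed
      have inv: "inv_into (underS r ?\<beta>) (e ?\<beta>) (e ?\<beta> (y i j)) = y i j"
        by (rule inv_into_f_f[OF e_inj yb[OF ij ij(2)]])
      \<comment> \<open>Only the tag \<open>\<delta>\<close> occurs in \<open>D (y i j)\<close>, and
        the range condition on \<open>p \<delta>\<close> puts the value into the domain of this
        graph.\<close>
      have "(SOME w. \<exists>\<delta>'. (\<delta>', p \<delta>' ?x ?\<beta>, w) \<in> D (y i j)) = \<zeta> i j (p \<delta> ?x ?\<beta>)"
        unfolding y
        by (rule some_equality) (use p[OF ab[OF x bj[OF ij(2)]], of \<delta>] in auto)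
      then show ?thesis
        using rd[folded a_def, OF bj[OF ij(2)] x]
        by (simp add: f_def a_def[symmetric] pos c0(2) v inv)
    qed
    moreover have "(x, \<beta>) \<in> r \<and> x \<noteq> \<beta>" if "x \<in> a" "\<beta> \<in> b" for x \<beta>
      using ab[OF that] unfolding underS_def by blast
    ultimately show ?thesis by (intro bexI[of _ a, OF _ aA] bexI[of _ b, OF _ b(1)]) blast
  qed
  show ?thesis
    unfolding Pr0_seq_def
    by (intro exI[of _ f] allI impI, elim conjE, rule main) (erule bspec | assumption)+
qed

end

theorem theorem4p10:
  fixes r :: "'a rel" and k :: 'a and p :: "'a \<Rightarrow> 'a \<Rightarrow> 'a \<Rightarrow> 'a"
    and \<theta> :: "'a \<Rightarrow> 'a"
  assumes GCH: "GCH_upto TYPE('a)"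
    and r: "card_order r"
    and k_card: "card_order_on (underS r k) (Restr r (underS r k))"
    and k_inf: "infinite (underS r k)"
    and k_reg: "regularCard (Restr r (underS r k))"
    and r_kpp: "(r, cardSuc (cardSuc (Restr r (underS r k)))) \<in> ordIso"
    and \<theta>_le: "\<forall>\<delta>. (Restr r (underS r (\<theta> \<delta>)), cardSuc (Restr r (underS r k))) \<in> ordLeq"
    and p_range: "\<forall>\<delta> x y. (x, y) \<in> r \<and> x \<noteq> y \<longrightarrow> p \<delta> x y \<in> underS r (\<theta> \<delta>)"
  shows "Pr0_seq r k p"
proof -
  let ?K = "underS r k" and ?\<kappa> = "Restr r (underS r k)"
  have \<kappa>: "Card_order ?\<kappa>" using card_order_on_Card_order[OF k_card] by blast
  have \<kappa>': "Card_order (cardSuc ?\<kappa>)" by (rule cardSuc_Card_order[OF \<kappa>])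
  have suc: "cardSuc ?\<kappa> =o cardSuc |?K|"
    using card_of_unique[OF k_card] cardSuc_invar_ordIso[OF \<kappa> card_of_Card_order] by blast
  have Fr: "Field r = UNIV" using card_order_on_Card_order[OF r] by auto
  have "cardSuc ?\<kappa> \<le>o r"
    by (rule ordLeq_ordIso_trans[OF cardSuc_ordLeq[OF \<kappa>'] ordIso_symmetric[OF r_kpp]])
  then have "|Field (cardSuc ?\<kappa>)| \<le>o |UNIV :: 'a set|" using card_of_mono2 Fr by metis
  \<comment> \<open>Levels and codes live in the type of the ordinals, so
    \<open>\<kappa>\<^sup>+\<close> is copied to a subset \<open>M\<close> of it, to which
    \<open>GCH_upto\<close> applies.\<close>
  then obtain M :: "'a set" where "|Field (cardSuc ?\<kappa>)| =o |M|"
    using internalize_card_of_ordLeq2[of "Field (cardSuc ?\<kappa>)" "UNIV :: 'a set"] by blast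
  from ordIso_transitive[OF ordIso_symmetric[OF card_of_Field_ordIso[OF \<kappa>']] this]
  have \<kappa>M: "cardSuc ?\<kappa> =o |M|" .
  have rM: "r =o cardSuc |M|"
    using r_kpp \<kappa>M cardSuc_invar_ordIso[OF \<kappa>' card_of_Card_order] ordIso_transitive by blast
  interpret double_successor r ?K M
    by unfold_locales
      (fact r k_inf rM ordIso_transitive[OF ordIso_symmetric[OF \<kappa>M] suc])+
  show ?thesis
  proof (rule Pr0_seq_if_GCH)
    show "|Pow ?K| =o cardSuc |?K|" "|Pow M| =o cardSuc |M|"
      using GCH k_inf M_inf unfolding GCH_upto_def by blast+
    show "|underS r (\<theta> \<delta>)| \<le>o |M|" for \<delta>
    proof -
      have "Restr r (underS r (\<theta> \<delta>)) \<le>o |M|" using \<theta>_le \<kappa>M ordLeq_ordIso_trans by blast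
      from card_of_mono2[OF this] show ?thesis
        using Refl_Field_Restr2[OF wo.REFL, of "underS r (\<theta> \<delta>)"] by (simp add: Fr Field_card_of)
    qed
    show "p \<delta> x y \<in> underS r (\<theta> \<delta>)" if "x \<in> underS r y" for \<delta> x y
      using p_range that unfolding underS_def by blast
  qed simp
qed

end
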